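(* Let $\mathcal{R}$ be a commutative ring containing $\mathbb{Q}$ and let $\phi(x)=\sum_{k\ge0}\phi[k]\frac{x^k}{k!}\in\mathcal{R}[[x]]$. The generating series $Y_n^\phi(\mathbf{x},\mathbf{q})$ of forests of $\phi$-enriched increasing trees with $n$ internal vertices satisfies $Y_1^{\phi}(x_1,q_0)=\phi(x_1)q_0$ and, for $n\ge2$, $$Y_n^\phi(\mathbf{x},\mathbf{q})=\phi(x_1)q_0\,Y_{n-1}^\phi(\mathbf{x},\mathbf{q})+\sum_{i=1}^{n-1}\phi(x_{i+1})\,q_i\,\partial_{x_i}Y_{n-1}^\phi(\mathbf{x},\mathbf{q}).$$
   Context: Consider forests (unordered sets) of (non-plane) rooted trees on a vertex set $[n]\uplus V$, where $[n]=\{1,\dots,n\}$ is the set of internal vertices and $V$ the set of leaves, such that all roots are internal vertices, the elements of $V$ have no children, and internal labels increase along each path starting at a root (internal vertices may have no children). The height $\mathrm{ht}(v)$ of a vertex is its distance to the root of its tree, and $T^{-1}(v)$ is the set of all children of $v$. For $\mathbf{k}=(k_1,\dots,k_n)$ and any finite set $V$ with a map $\kappa:V\to\{1,\dots,n\}$ satisfying $|\kappa^{-1}(i)|=k_i$, the coefficient of $\frac{x_1^{k_1}\cdots x_n^{k_n}}{k_1!\cdots k_n!}$ in $Y^\phi_{n}(\mathbf{x},\mathbf{q})$ is $\sum\prod_{v\in[n]}\phi[|T^{-1}(v)|]\,q_{\mathrm{ht}(v)}$, the sum being over all such forests (with any number of trees from $1$ to $n$) in which every leaf $v\in V$ has height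 $\kappa(v)$. *)

theory Defs
  imports
    "HOL-Library.Poly_Mapping"
    "HOL-Computational_Algebra.Formal_Power_Series"
begin

section \<open>Commutative rings containing the rationals\<close>

definition rat_embedding :: "(rat \<Rightarrow> 'r::comm_ring_1) \<Rightarrow> bool" where
  "rat_embedding \<iota> \<longleftrightarrow> inj \<iota> \<and> \<iota> 1 = 1 \<and>
     (\<forall>a b. \<iota> (a + b) = \<iota> a + \<iota> b) \<and> (\<forall>a b. \<iota> (a * b) = \<iota> a * \<iota> b)"

definition egf :: "(rat \<Rightarrow> 'r::comm_ring_1) \<Rightarrow> (nat \<Rightarrow> 'r) \<Rightarrow> 'r fps" where
  "egf \<iota> \<phi> = Abs_fps (\<lambda>k. \<phi> k * \<iota> (1 / fact k))"


section \<open>Multivariate formal power series\<close>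

text \<open>Power series in the variables \<open>x\<^sub>0, x\<^sub>1, \<dots>\<close>. A monomial is its finitely supported
  exponent vector. A series in \<open>x\<^sub>1, \<dots>, x\<^sub>n\<close> is one whose coefficients vanish on all
  monomials containing another variable.\<close>

type_synonym monom = "nat \<Rightarrow>\<^sub>0 nat"

typedef 'a mps = "UNIV :: (monom \<Rightarrow> 'a) set"
  morphisms mps_coeff Abs_mps ..

lemma mps_coeff_Abs [simp]: "mps_coeff (Abs_mps f) = f"
  by (simp add: Abs_mps_inverse)

lemma mps_eqI: "(\<And>m. mps_coeff f m = mps_coeff g m) \<Longrightarrow> f = g"
  by (metis ext mps_coeff_inverse)

definition splits :: "monom \<Rightarrow> (monom \<times> monom) set" where
  "splits m = {(a, b). a + b = m}"

lemma finite_splits [simp]: "finite (splits m)"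
proof -
  let ?A = "Poly_Mapping.keys m"
  let ?B = "\<Union>i\<in>?A. {..Poly_Mapping.lookup m i}"
  let ?S = "{f. \<forall>x. (x \<in> ?A \<longrightarrow> f x \<in> ?B) \<and> (x \<notin> ?A \<longrightarrow> f x = (0::nat))}"
  have fin: "finite ?S"
    by (rule finite_set_of_finite_funs) auto
  have "Poly_Mapping.lookup ` fst ` splits m \<subseteq> ?S"
  proof
    fix f assume "f \<in> Poly_Mapping.lookup ` fst ` splits m"
    then obtain a b where f: "f = Poly_Mapping.lookup a" and ab: "a + b = m"
      by (auto simp: splits_def)
    have le: "f x \<le> Poly_Mapping.lookup m x" for x
      using ab f by (auto simp: lookup_add)
    have "f x \<in> ?B" if "x \<in> ?A" for x
      using that le by blast
    moreover have "f x = 0" if "x \<notin> ?A" for x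
      using that le[of x] by (simp add: in_keys_iff)
    ultimately show "f \<in> ?S" by simp
  qed
  then have "finite (Poly_Mapping.lookup ` fst ` splits m)"
    using fin by (rule finite_subset)
  then have "finite (fst ` splits m)"
    by (rule finite_imageD) (simp add: inj_on_def poly_mapping.lookup_inject)
  moreover have "inj_on fst (splits m)"
    by (auto simp: inj_on_def splits_def)
  ultimately show ?thesis
    by (rule finite_imageD)
qed

instantiation mps :: (comm_ring_1) comm_ring_1
begin

definition zero_mps_def: "0 = Abs_mps (\<lambda>m. 0)"
definition one_mps_def: "1 = Abs_mps (\<lambda>m. if m = 0 then 1 else 0)"
definition plus_mps_def: "f + g = Abs_mps (\<lambda>m. mps_coeff f m + mps_coeff g m)"
definition minus_mps_def: "f - g = Abs_mps (\<lambda>m. mps_coeff f m - mps_coeff g m)"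
definition uminus_mps_def: "- f = Abs_mps (\<lambda>m. - mps_coeff f m)"
definition times_mps_def:
  "f * g = Abs_mps (\<lambda>m. \<Sum>(a, b)\<in>splits m. mps_coeff f a * mps_coeff g b)"

instance
proof
  fix f g h :: "'a mps"
  show "f * g * h = f * (g * h)"
  proof (rule mps_eqI)
    fix m
    let ?c = mps_coeff
    have "?c (f * g * h) m = (\<Sum>(p, c)\<in>splits m. \<Sum>(a, b)\<in>splits p. ?c f a * ?c g b * ?c h c)"
      by (simp add: times_mps_def sum_distrib_right case_prod_beta)
    also have "\<dots> = (\<Sum>((p, c), (a, b))\<in>(SIGMA s:splits m. splits (fst s)). ?c f a * ?c g b * ?c h c)"
      by (subst sum.Sigma[symmetric]) (auto simp: case_prod_beta)
    also have "\<dots> = (\<Sum>((a, p), (b, c))\<in>(SIGMA s:splits m. splits (snd s)). ?c f a * ?c g b * ?c h c)"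
      by (rule sum.reindex_bij_witness[where
            i = "\<lambda>((a, p), (b, c)). ((a + b, c), (a, b))" and
            j = "\<lambda>((p, c), (a, b)). ((a, b + c), (b, c))"])
        (auto simp: splits_def ac_simps)
    also have "\<dots> = (\<Sum>(a, p)\<in>splits m. \<Sum>(b, c)\<in>splits p. ?c f a * ?c g b * ?c h c)"
      by (subst sum.Sigma[symmetric]) (auto simp: case_prod_beta)
    also have "\<dots> = ?c (f * (g * h)) m"
      by (simp add: times_mps_def sum_distrib_left case_prod_beta ac_simps)
    finally show "?c (f * g * h) m = ?c (f * (g * h)) m" .
  qed
  show "f * g = g * f"
  proof (rule mps_eqI)
    fix m
    show "mps_coeff (f * g) m = mps_coeff (g * f) m"
      unfolding times_mps_def mps_coeff_Abs
      by (rule sum.reindex_bij_witness[where i = prod.swap and j = prod.swap])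
        (auto simp: splits_def ac_simps)
  qed
  show "1 * f = f"
  proof (rule mps_eqI)
    fix m
    have "mps_coeff (1 * f) m =
        (\<Sum>s\<in>splits m. if s = (0, m) then mps_coeff f (snd s) else 0)"
      unfolding times_mps_def one_mps_def mps_coeff_Abs
      by (rule sum.cong) (auto simp: splits_def split: if_splits)
    also have "\<dots> = mps_coeff f m"
      by (subst sum.delta) (use finite_splits[of m] in \<open>auto simp: splits_def\<close>)
    finally show "mps_coeff (1 * f) m = mps_coeff f m" .
  qed
  show "(f + g) * h = f * h + g * h"
    by (rule mps_eqI)
      (simp add: times_mps_def plus_mps_def case_prod_beta distrib_right sum.distrib)
  show "(0::'a mps) \<noteq> 1"
  proof
    assume "(0::'a mps) = 1"
    then have "mps_coeff (0::'a mps) 0 = mps_coeff 1 0" by simp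
    then show False by (simp add: zero_mps_def one_mps_def)
  qed
qed (auto intro!: mps_eqI simp: plus_mps_def zero_mps_def minus_mps_def uminus_mps_def ac_simps)

end

definition mps_const :: "'a::zero \<Rightarrow> 'a mps" where
  "mps_const c = Abs_mps (\<lambda>m. if m = 0 then c else 0)"

definition mps_deriv :: "nat \<Rightarrow> 'a::comm_ring_1 mps \<Rightarrow> 'a mps" where
  "mps_deriv i f = Abs_mps (\<lambda>m. of_nat (Poly_Mapping.lookup m i + 1) *
     mps_coeff f (m + Poly_Mapping.single i 1))"


section \<open>Coefficients: polynomials in \<open>q\<^sub>0, q\<^sub>1, \<dots>\<close>\<close>

type_synonym 'r qpoly = "monom \<Rightarrow>\<^sub>0 'r"

definition qconst :: "'r::comm_ring_1 \<Rightarrow> 'r qpoly" where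
  "qconst c = Poly_Mapping.single 0 c"

definition qvar :: "nat \<Rightarrow> 'r::comm_ring_1 qpoly" where
  "qvar i = Poly_Mapping.single (Poly_Mapping.single i 1) 1"

text \<open>The substitution \<open>f(x\<^sub>i)\<close> for a univariate power series \<open>f\<close>.\<close>

definition fps_at_var :: "'r::comm_ring_1 fps \<Rightarrow> nat \<Rightarrow> 'r qpoly mps" where
  "fps_at_var f i = Abs_mps (\<lambda>m. if Poly_Mapping.keys m \<subseteq> {i}
     then qconst (fps_nth f (Poly_Mapping.lookup m i)) else 0)"


section \<open>Forests of increasing trees\<close>

text \<open>A rooted forest on a finite vertex set \<open>W\<close> is given by its set of edges, directed from
  parent to child; the roots are the vertices without a parent. Since no order is imposed on
  children or on trees, the trees are non-plane and the forest is unordered.\<close>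

definition rooted_forest :: "'w set \<Rightarrow> ('w \<times> 'w) set \<Rightarrow> bool" where
  "rooted_forest W E \<longleftrightarrow> E \<subseteq> W \<times> W \<and> acyclic E \<and>
     (\<forall>u u' v. (u, v) \<in> E \<and> (u', v) \<in> E \<longrightarrow> u = u')"

definition is_root :: "'w set \<Rightarrow> ('w \<times> 'w) set \<Rightarrow> 'w \<Rightarrow> bool" where
  "is_root W E v \<longleftrightarrow> v \<in> W \<and> v \<notin> Range E"

definition children :: "('w \<times> 'w) set \<Rightarrow> 'w \<Rightarrow> 'w set" where
  "children E v = {w. (v, w) \<in> E}"

text \<open>In a forest exactly one root reaches \<open>v\<close>, namely the root of the tree of \<open>v\<close>.\<close>

definition height :: "'w set \<Rightarrow> ('w \<times> 'w) set \<Rightarrow> 'w \<Rightarrow> nat" where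
  "height W E v = (LEAST k. \<exists>r. is_root W E r \<and> (r, v) \<in> E ^^ k)"

definition vertices :: "nat \<Rightarrow> 'v set \<Rightarrow> (nat + 'v) set" where
  "vertices n V = {1..n} <+> V"

definition increasing_forests :: "nat \<Rightarrow> 'v set \<Rightarrow> ('v \<Rightarrow> nat) \<Rightarrow>
    ((nat + 'v) \<times> (nat + 'v)) set set" where
  "increasing_forests n V \<kappa> = {E.
     rooted_forest (vertices n V) E \<and>
     (\<forall>r. is_root (vertices n V) E r \<longrightarrow> r \<in> Inl ` {1..n}) \<and>
     (\<forall>v\<in>V. children E (Inr v) = {}) \<and>
     (\<forall>i j. (Inl i, Inl j) \<in> E\<^sup>+ \<longrightarrow> i < j) \<and>
     (\<forall>v\<in>V. height (vertices n V) E (Inr v) = \<kappa> v)}"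

definition forest_weight :: "(nat \<Rightarrow> 'r::comm_ring_1) \<Rightarrow> nat \<Rightarrow> 'v set \<Rightarrow>
    ((nat + 'v) \<times> (nat + 'v)) set \<Rightarrow> 'r qpoly" where
  "forest_weight \<phi> n V E =
     (\<Prod>v\<in>{1..n}. qconst (\<phi> (card (children E (Inl v)))) * qvar (height (vertices n V) E (Inl v)))"

definition forest_sum :: "(nat \<Rightarrow> 'r::comm_ring_1) \<Rightarrow> nat \<Rightarrow> 'v set \<Rightarrow> ('v \<Rightarrow> nat) \<Rightarrow> 'r qpoly" where
  "forest_sum \<phi> n V \<kappa> = (\<Sum>E\<in>increasing_forests n V \<kappa>. forest_weight \<phi> n V E)"


section \<open>The generating series\<close>

text \<open>The leaf set used for the coefficient at \<open>k = (k\<^sub>1, \<dots>, k\<^sub>n)\<close> consists of the pairs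
  \<open>(i, j)\<close> with \<open>j < k\<^sub>i\<close>, and \<open>\<kappa>(i, j) = i\<close>. The lemma \<open>Y_series_coeff\<close> below shows that any
  other admissible choice of leaves gives the same series.\<close>

definition leaf_set :: "nat \<Rightarrow> monom \<Rightarrow> (nat \<times> nat) set" where
  "leaf_set n k = (SIGMA i:{1..n}. {..<Poly_Mapping.lookup k i})"

definition Y_series :: "(rat \<Rightarrow> 'r::comm_ring_1) \<Rightarrow> (nat \<Rightarrow> 'r) \<Rightarrow> nat \<Rightarrow> 'r qpoly mps" where
  "Y_series \<iota> \<phi> n = Abs_mps (\<lambda>k.
     if Poly_Mapping.keys k \<subseteq> {1..n}
     then qconst (\<iota> (1 / (\<Prod>i\<in>{1..n}. fact (Poly_Mapping.lookup k i)))) *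
          forest_sum \<phi> n (leaf_set n k) fst
     else 0)"


section \<open>Independence of the choice of leaves\<close>

lemma relpow_image:
  assumes "(r, v) \<in> E ^^ k"
  shows "(h r, h v) \<in> (map_prod h h ` E) ^^ k"
  using assms
proof (induction k arbitrary: v)
  case (Suc k)
  then obtain u where "(r, u) \<in> E ^^ k" "(u, v) \<in> E" by auto
  then show ?case using Suc.IH[of u] by (auto intro!: relcompI)
qed auto

lemma is_root_image:
  assumes "E \<subseteq> W \<times> W" "inj_on h W" "is_root W E r"
  shows "is_root (h ` W) (map_prod h h ` E) (h r)"
proof -
  have r: "r \<in> W" "r \<notin> Range E" using assms(3) by (auto simp: is_root_def)
  have False if ab: "(a, b) \<in> E" "h r = h b" for a b
  proof -
    have "b \<in> W" using ab(1) assms(1) by blast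
    then have "r = b" using ab(2) r(1) assms(2) by (simp add: inj_on_def)
    then show False using ab(1) r(2) by blast
  qed
  then have "h r \<notin> Range (map_prod h h ` E)" by auto
  then show ?thesis using r by (simp add: is_root_def)
qed

lemma image_back:
  assumes "E \<subseteq> W \<times> W" "inj_on h W"
  shows "map_prod (the_inv_into W h) (the_inv_into W h) ` map_prod h h ` E = E"
proof -
  have "map_prod (the_inv_into W h) (the_inv_into W h) (map_prod h h e) = e" if "e \<in> E" for e
    using that assms by (cases e) (auto simp: the_inv_into_f_f)
  then show ?thesis by (simp add: image_image)
qed

lemma height_image:
  assumes E: "E \<subseteq> W \<times> W" and inj: "inj_on h W" and v: "v \<in> W"
  shows "height (h ` W) (map_prod h h ` E) (h v) = height W E v"
proof -
  let ?h = "the_inv_into W h" and ?E = "map_prod h h ` E"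
  have inv_img: "map_prod ?h ?h ` ?E = E" by (rule image_back[OF E inj])
  have W: "?h ` h ` W = W" using inj by (simp add: image_image the_inv_into_f_f)
  have subs: "?E \<subseteq> h ` W \<times> h ` W" using E by auto
  have inj': "inj_on ?h (h ` W)" using inj by (simp add: inj_on_the_inv_into)
  have "(\<exists>r. is_root (h ` W) ?E r \<and> (r, h v) \<in> ?E ^^ k) \<longleftrightarrow>
        (\<exists>r. is_root W E r \<and> (r, v) \<in> E ^^ k)" for k
  proof
    assume "\<exists>r. is_root W E r \<and> (r, v) \<in> E ^^ k"
    then obtain r where r: "is_root W E r" "(r, v) \<in> E ^^ k" by blast
    show "\<exists>r. is_root (h ` W) ?E r \<and> (r, h v) \<in> ?E ^^ k"
      using is_root_image[OF E inj r(1)] relpow_image[OF r(2), of h] by blast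
  next
    assume "\<exists>r. is_root (h ` W) ?E r \<and> (r, h v) \<in> ?E ^^ k"
    then obtain r where r: "is_root (h ` W) ?E r" "(r, h v) \<in> ?E ^^ k" by blast
    have "is_root W E (?h r)"
      using is_root_image[OF subs inj' r(1)] by (simp add: inv_img W)
    moreover have "(?h r, v) \<in> E ^^ k"
      using relpow_image[OF r(2), of ?h] v inj by (simp add: inv_img the_inv_into_f_f)
    ultimately show "\<exists>r. is_root W E r \<and> (r, v) \<in> E ^^ k" by blast
  qed
  then show ?thesis unfolding height_def by simp
qed

lemma trancl_image:
  assumes "(x, y) \<in> E\<^sup>+"
  shows "(h x, h y) \<in> (map_prod h h ` E)\<^sup>+"
  using assms by (auto simp: trancl_power intro: relpow_image)

lemma children_image:
  assumes "E \<subseteq> W \<times> W" "inj_on h W" "v \<in> W"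
  shows "children (map_prod h h ` E) (h v) = h ` children E v"
proof -
  have "(v, b) \<in> E" if "(a, b) \<in> E" "h v = h a" for a b
  proof -
    have "a \<in> W" using that(1) assms(1) by blast
    then have "v = a" using that(2) assms(2,3) by (simp add: inj_on_def)
    then show ?thesis using that(1) by simp
  qed
  then show ?thesis unfolding children_def by force
qed

lemma forest_transport:
  assumes bij: "bij_betw g V V'" and kappa: "\<And>v. v \<in> V \<Longrightarrow> \<kappa>' (g v) = \<kappa> v"
    and F: "E \<in> increasing_forests n V \<kappa>"
  defines "h \<equiv> map_sum id g"
  shows "map_prod h h ` E \<in> increasing_forests n V' \<kappa>'"
    and "forest_weight \<phi> n V' (map_prod h h ` E) = forest_weight \<phi> n V E"
proof -
  let ?W = "vertices n V" and ?W' = "vertices n V'" and ?E = "map_prod h h ` E"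
  let ?h = "the_inv_into ?W h"
  have W': "h ` ?W = ?W'"
    using bij unfolding bij_betw_def
    by (auto simp: vertices_def h_def Plus_def image_Un image_image)
  have inj: "inj_on h ?W"
  proof (rule inj_onI)
    fix x y assume "x \<in> ?W" "y \<in> ?W" "h x = h y"
    then show "x = y"
      using bij by (cases x; cases y) (auto simp: vertices_def h_def bij_betw_def dest: inj_onD)
  qed
  have E: "E \<subseteq> ?W \<times> ?W" and acyc: "acyclic E"
    and uniq: "\<And>u u' v. (u, v) \<in> E \<Longrightarrow> (u', v) \<in> E \<Longrightarrow> u = u'"
    and roots: "\<And>r. is_root ?W E r \<Longrightarrow> r \<in> Inl ` {1..n}"
    and leaves: "\<And>v. v \<in> V \<Longrightarrow> children E (Inr v) = {}"
    and incr: "\<And>i j. (Inl i, Inl j) \<in> E\<^sup>+ \<Longrightarrow> i < j"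
    and hts: "\<And>v. v \<in> V \<Longrightarrow> height ?W E (Inr v) = \<kappa> v"
    using F unfolding increasing_forests_def rooted_forest_def by blast+
  have subs: "?E \<subseteq> ?W' \<times> ?W'" using E W' by auto
  have inv_img: "map_prod ?h ?h ` ?E = E" by (rule image_back[OF E inj])
  have Wback: "?h ` ?W' = ?W" unfolding W'[symmetric] using inj by (simp add: image_image the_inv_into_f_f)
  have inj': "inj_on ?h ?W'" unfolding W'[symmetric] using inj by (rule inj_on_the_inv_into)
  have h_back: "h (?h w) = w" if "w \<in> ?W'" for w
    using that inj W' by (simp add: f_the_inv_into_f)
  have Inl_W: "Inl i \<in> ?W" if "i \<in> {1..n}" for i using that by (auto simp: vertices_def)
  have Inr_W: "Inr v \<in> ?W" if "v \<in> V" for v using that by (auto simp: vertices_def)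
  have hInl [simp]: "h (Inl i) = Inl i" for i by (simp add: h_def)
  have hInr [simp]: "h (Inr v) = Inr (g v)" for v by (simp add: h_def)
  have 1: "rooted_forest ?W' ?E"
    unfolding rooted_forest_def
  proof (intro conjI allI impI)
    show "?E \<subseteq> ?W' \<times> ?W'" by (rule subs)
    show "acyclic ?E"
      unfolding acyclic_def
    proof (intro allI notI)
      fix x assume "(x, x) \<in> ?E\<^sup>+"
      from trancl_image[OF this, of ?h] show False
        using acyc unfolding inv_img acyclic_def by blast
    qed
    fix u u' v assume "(u, v) \<in> ?E \<and> (u', v) \<in> ?E"
    then obtain a b a' b' where *: "(a, b) \<in> E" "(a', b') \<in> E" "u = h a" "u' = h a'"
      "v = h b" "v = h b'" by auto
    then have "b = b'" using E inj by (metis SigmaD2 inj_onD subsetD)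
    then show "u = u'" using * uniq by blast
  qed
  have 2: "r \<in> Inl ` {1..n}" if r: "is_root ?W' ?E r" for r
  proof -
    have "is_root ?W E (?h r)"
      using is_root_image[OF subs inj' r] by (simp add: inv_img Wback)
    then have "?h r \<in> Inl ` {1..n}" by (rule roots)
    then have "h (?h r) \<in> Inl ` {1..n}" by auto
    then show ?thesis using h_back r by (simp add: is_root_def)
  qed
  have surj: "\<exists>u\<in>V. v = g u" if "v \<in> V'" for v
    using that bij by (auto simp: bij_betw_def)
  have 3: "children ?E (Inr v) = {}" if v: "v \<in> V'" for v
  proof -
    obtain u where u: "u \<in> V" "v = g u" using surj[OF v] by blast
    then show ?thesis
      using children_image[OF E inj Inr_W[OF u(1)]] leaves[OF u(1)] by simp
  qed
  have 4: "height ?W' ?E (Inr v) = \<kappa>' v" if v: "v \<in> V'" for v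
  proof -
    obtain u where u: "u \<in> V" "v = g u" using surj[OF v] by blast
    then show ?thesis
      using height_image[OF E inj Inr_W[OF u(1)]] hts[OF u(1)] kappa[OF u(1)] by (simp add: W')
  qed
  have 5: "i < j" if ij: "(Inl i, Inl j) \<in> ?E\<^sup>+" for i j
  proof -
    have "?E\<^sup>+ \<subseteq> ?W' \<times> ?W'" using subs trancl_subset_Sigma by blast
    then have "Inl i \<in> ?W'" "Inl j \<in> ?W'" using ij by blast+
    then have "i \<in> {1..n}" "j \<in> {1..n}" by (auto simp: vertices_def)
    then have "?h (Inl i) = Inl i" "?h (Inl j) = Inl j"
      by (metis Inl_W hInl inj the_inv_into_f_f)+
    then have "(Inl i, Inl j) \<in> E\<^sup>+"
      using trancl_image[OF ij, of ?h] by (simp add: inv_img)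
    then show ?thesis by (rule incr)
  qed
  show "?E \<in> increasing_forests n V' \<kappa>'"
    using 1 2 3 4 5 unfolding increasing_forests_def by blast
  have "card (children ?E (Inl i)) = card (children E (Inl i))" if "i \<in> {1..n}" for i
  proof -
    have "children E (Inl i) \<subseteq> ?W" using E by (auto simp: children_def)
    then have "inj_on h (children E (Inl i))" using inj inj_on_subset by blast
    then show ?thesis
      using children_image[OF E inj Inl_W[OF that]] by (simp add: card_image)
  qed
  moreover have "height ?W' ?E (Inl i) = height ?W E (Inl i)" if "i \<in> {1..n}" for i
    using height_image[OF E inj Inl_W[OF that]] by (simp add: W')
  ultimately show "forest_weight \<phi> n V' ?E = forest_weight \<phi> n V E"
    unfolding forest_weight_def by (intro prod.cong) auto
qed

lemma forest_sum_cong: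
  assumes bij: "bij_betw g V V'" and kappa: "\<And>v. v \<in> V \<Longrightarrow> \<kappa>' (g v) = \<kappa> v"
  shows "forest_sum \<phi> n V \<kappa> = forest_sum \<phi> n V' \<kappa>'"
proof -
  let ?g = "the_inv_into V g"
  let ?j = "\<lambda>E. map_prod (map_sum id g) (map_sum id g) ` E"
  let ?i = "\<lambda>E. map_prod (map_sum id ?g) (map_sum id ?g) ` E"
  have bij': "bij_betw ?g V' V" by (rule bij_betw_the_inv_into[OF bij])
  have gg: "?g (g v) = v" if "v \<in> V" for v
    using that bij by (simp add: bij_betw_def the_inv_into_f_f)
  have gg': "g (?g v) = v" if "v \<in> V'" for v
    using that bij by (metis bij_betw_def f_the_inv_into_f)
  have kappa': "\<kappa> (?g v) = \<kappa>' v" if "v \<in> V'" for v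
    using kappa[of "?g v"] gg'[OF that] bij' that by (metis bij_betwE)
  have id1: "?i (?j E) = E" if "E \<in> increasing_forests n V \<kappa>" for E
  proof -
    have E: "E \<subseteq> vertices n V \<times> vertices n V"
      using that by (simp add: increasing_forests_def rooted_forest_def)
    have fixed: "map_sum id ?g (map_sum id g w) = w" if "w \<in> vertices n V" for w
      using that gg by (auto simp: vertices_def)
    have "map_prod (map_sum id ?g) (map_sum id ?g) (map_prod (map_sum id g) (map_sum id g) e) = e"
      if "e \<in> E" for e
      using E that fixed by (cases e) auto
    then show ?thesis by (simp add: image_image)
  qed
  have id2: "?j (?i E) = E" if "E \<in> increasing_forests n V' \<kappa>'" for E
  proof -
    have E: "E \<subseteq> vertices n V' \<times> vertices n V'"
      using that by (simp add: increasing_forests_def rooted_forest_def)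
    have fixed: "map_sum id g (map_sum id ?g w) = w" if "w \<in> vertices n V'" for w
      using that gg' by (auto simp: vertices_def)
    have "map_prod (map_sum id g) (map_sum id g) (map_prod (map_sum id ?g) (map_sum id ?g) e) = e"
      if "e \<in> E" for e
      using E that fixed by (cases e) auto
    then show ?thesis by (simp add: image_image)
  qed
  have t1: "?j E \<in> increasing_forests n V' \<kappa>'" if "E \<in> increasing_forests n V \<kappa>" for E
    by (rule forest_transport(1)[where \<kappa> = \<kappa> and V = V]) (use bij kappa that in auto)
  have t2: "?i E \<in> increasing_forests n V \<kappa>" if "E \<in> increasing_forests n V' \<kappa>'" for E
    by (rule forest_transport(1)[where \<kappa> = \<kappa>' and V = V']) (use bij' kappa' that in auto)
  have t3: "forest_weight \<phi> n V' (?j E) = forest_weight \<phi> n V E"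
    if "E \<in> increasing_forests n V \<kappa>" for E
    by (rule forest_transport(2)[where \<kappa> = \<kappa> and \<kappa>' = \<kappa>']) (use bij kappa that in auto)
  show ?thesis
    unfolding forest_sum_def
    by (rule sum.reindex_bij_witness[where i = ?i and j = ?j])
      (simp_all only: id1 id2 t1 t2 t3)
qed

lemma Y_series_coeff:
  assumes fin: "finite V" and range: "\<kappa> ` V \<subseteq> {1..n}"
    and card: "\<And>i. i \<in> {1..n} \<Longrightarrow> card {v \<in> V. \<kappa> v = i} = Poly_Mapping.lookup k i"
    and supp: "Poly_Mapping.keys k \<subseteq> {1..n}"
  shows "mps_coeff (Y_series \<iota> \<phi> n) k =
    qconst (\<iota> (1 / (\<Prod>i\<in>{1..n}. fact (Poly_Mapping.lookup k i)))) * forest_sum \<phi> n V \<kappa>"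
proof -
  have "\<exists>f. bij_betw f {v \<in> V. \<kappa> v = i} {..<Poly_Mapping.lookup k i}" if "i \<in> {1..n}" for i
    using fin card[OF that] by (intro finite_same_card_bij) auto
  then obtain f where
    f: "\<And>i. i \<in> {1..n} \<Longrightarrow> bij_betw (f i) {v \<in> V. \<kappa> v = i} {..<Poly_Mapping.lookup k i}"
    by metis
  let ?g = "\<lambda>v. (\<kappa> v, f (\<kappa> v) v)"
  have "bij_betw ?g V (leaf_set n k)"
    unfolding bij_betw_def
  proof (intro conjI subset_antisym subsetI)
    show "inj_on ?g V"
    proof (rule inj_onI)
      fix u v assume *: "u \<in> V" "v \<in> V" "?g u = ?g v"
      then have "\<kappa> u \<in> {1..n}" "\<kappa> v = \<kappa> u" "f (\<kappa> u) u = f (\<kappa> u) v" using range by auto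
      with * f[of "\<kappa> u"] show "u = v" unfolding bij_betw_def inj_on_def by simp
    qed
  next
    fix p assume "p \<in> ?g ` V"
    then obtain v where v: "v \<in> V" "p = ?g v" by blast
    then have "\<kappa> v \<in> {1..n}" using range by blast
    then show "p \<in> leaf_set n k"
      using v bij_betwE[OF f[of "\<kappa> v"]] by (auto simp: leaf_set_def)
  next
    fix p assume "p \<in> leaf_set n k"
    then obtain i j where p: "p = (i, j)" "i \<in> {1..n}" "j \<in> {..<Poly_Mapping.lookup k i}"
      by (auto simp: leaf_set_def)
    then have "j \<in> f i ` {v \<in> V. \<kappa> v = i}" using f[of i] by (simp add: bij_betw_def)
    then show "p \<in> ?g ` V" using p by auto
  qed
  then have "forest_sum \<phi> n V \<kappa> = forest_sum \<phi> n (leaf_set n k) fst"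
    by (rule forest_sum_cong) simp
  then show ?thesis using supp by (simp add: Y_series_def)
qed

end

theory Submission
  imports Defs
begin

text \<open>All children of the largest internal vertex \<open>n + 1\<close> are leaves. If it has height \<open>i\<close>, these
  children form a subset \<open>S\<close> of the leaves of height \<open>i + 1\<close>. Deleting \<open>S\<close> and turning \<open>n + 1\<close>
  into a leaf of height \<open>i\<close> (or deleting it, if \<open>i = 0\<close>) gives a forest with \<open>n\<close> internal vertices,
  and the step is reversible. It costs the factor \<open>\<phi>[|S|] q\<^sub>i\<close>; on exponential generating
  series, the choice of \<open>S\<close> is multiplication by \<open>\<phi>(x\<^bsub>i+1\<^esub>)\<close> and the extra leaf is \<open>\<partial>/\<partial>x\<^sub>i\<close>.
  The argument also applies to \<open>n = 0\<close>, with \<open>Y\<^sub>0 = 1\<close>.\<close>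

section \<open>Heights in increasing forests\<close>

text \<open>Only conditions on single edges are imposed: sources are internal, parents are unique,
  labels increase along an edge. Acyclicity and increase along paths follow from these. The
  conditions on the leaves are stated separately in \<open>increasing_forests_iff\<close>.\<close>

definition inc_forest :: "nat \<Rightarrow> 'v set \<Rightarrow> ((nat + 'v) \<times> (nat + 'v)) set \<Rightarrow> bool" where
  "inc_forest n V E \<longleftrightarrow> E \<subseteq> Inl ` {1..n} \<times> vertices n V \<and>
     (\<forall>u u' v. (u, v) \<in> E \<and> (u', v) \<in> E \<longrightarrow> u = u') \<and>
     (\<forall>i j. (Inl i, Inl j) \<in> E \<longrightarrow> i < j)"

lemma Inl_vertices [simp]: "Inl j \<in> vertices n V \<longleftrightarrow> j \<in> {1..n}"
  and Inr_vertices [simp]: "Inr v \<in> vertices n V \<longleftrightarrow> v \<in> V"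
  by (auto simp: vertices_def)

lemma inc_forestD:
  assumes "inc_forest n V E"
  shows "(u, v) \<in> E \<Longrightarrow> \<exists>i\<in>{1..n}. u = Inl i"
    and "(u, v) \<in> E \<Longrightarrow> v \<in> vertices n V"
    and "(u, v) \<in> E \<Longrightarrow> (u', v) \<in> E \<Longrightarrow> u = u'"
    and "(Inl i, Inl j) \<in> E \<Longrightarrow> i < j"
  using assms unfolding inc_forest_def by blast+

text \<open>Ranking an internal vertex by its label and every leaf by n + 1 makes each edge go up,
  since sources are internal with label at most n. This yields acyclicity and a measure for
  inductions from the roots downwards.\<close>

lemma inc_forest_rank_less:
  assumes "inc_forest n V E" "(x, y) \<in> E\<^sup>+"
  shows "case_sum id (\<lambda>_. Suc n) x < case_sum id (\<lambda>_. Suc n) y"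
proof -
  have edge: "case_sum id (\<lambda>_. Suc n) u < case_sum id (\<lambda>_. Suc n) v" if e: "(u, v) \<in> E" for u v
  proof -
    obtain i where "i \<in> {1..n}" "u = Inl i" using inc_forestD(1)[OF assms(1) e] by blast
    then show ?thesis using inc_forestD(4)[OF assms(1)] e by (cases v) auto
  qed
  show ?thesis
    using assms(2) by (induction rule: trancl_induct) (use edge in \<open>force dest: less_trans\<close>)+
qed

text \<open>A leaf is not a root exactly when it is the target of an edge, and the path conditions
  reduce to edge conditions by the rank argument. Modified forests can then be checked edge by
  edge.\<close>

lemma increasing_forests_iff:
  "E \<in> increasing_forests n V \<kappa> \<longleftrightarrow> inc_forest n V E \<and>
     (\<forall>v\<in>V. Inr v \<in> Range E \<and> height (vertices n V) E (Inr v) = \<kappa> v)"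
  (is "?L \<longleftrightarrow> ?R")
proof
  assume L: ?L
  have sub: "E \<subseteq> vertices n V \<times> vertices n V"
    and uniq: "\<And>u u' v. (u, v) \<in> E \<Longrightarrow> (u', v) \<in> E \<Longrightarrow> u = u'"
    and roots: "\<And>r. is_root (vertices n V) E r \<Longrightarrow> r \<in> Inl ` {1..n}"
    and leaves: "\<And>v. v \<in> V \<Longrightarrow> children E (Inr v) = {}"
    and incr: "\<And>i j. (Inl i, Inl j) \<in> E\<^sup>+ \<Longrightarrow> i < j"
    and hts: "\<And>v. v \<in> V \<Longrightarrow> height (vertices n V) E (Inr v) = \<kappa> v"
    using L unfolding increasing_forests_def rooted_forest_def by blast+
  have "u \<in> Inl ` {1..n}" if "(u, v) \<in> E" for u v
    using that sub leaves by (cases u) (auto simp: children_def)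
  moreover have "Inr v \<in> Range E" if "v \<in> V" for v
    using roots[of "Inr v"] that by (auto simp: is_root_def)
  ultimately show ?R
    using sub uniq incr hts unfolding inc_forest_def by blast
next
  assume R: ?R
  then have F: "inc_forest n V E" by blast
  have "acyclic E"
    unfolding acyclic_def using inc_forest_rank_less[OF F] by blast
  moreover have "E \<subseteq> vertices n V \<times> vertices n V"
    using F unfolding inc_forest_def by force
  moreover have "i < j" if "(Inl i, Inl j) \<in> E\<^sup>+" for i j
    using inc_forest_rank_less[OF F that] by simp
  moreover have "r \<in> Inl ` {1..n}" if "is_root (vertices n V) E r" for r
    using that R by (cases r) (auto simp: is_root_def)
  moreover have "children E (Inr v) = {}" for v
    using inc_forestD(1)[OF F] by (auto simp: children_def)
  ultimately show ?L
    using R inc_forestD(3)[OF F] unfolding increasing_forests_def rooted_forest_def by blast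
qed

text \<open>Passing to the parent lowers the rank, so the climb ends at a root. Hence the
  \<open>LEAST\<close> in \<open>height\<close> ranges over a nonempty set.\<close>

lemma inc_forest_root_reaches:
  assumes F: "inc_forest n V E" and "v \<in> vertices n V"
  shows "\<exists>k r. is_root (vertices n V) E r \<and> (r, v) \<in> E ^^ k"
  using assms(2)
proof (induction v rule: measure_induct_rule[where f = "case_sum id (\<lambda>_. Suc n)"])
  case (less v)
  show ?case
  proof (cases "is_root (vertices n V) E v")
    case True
    then show ?thesis by (metis relpow_0_I)
  next
    case False
    then obtain u where u: "(u, v) \<in> E" using less.prems by (auto simp: is_root_def)
    then have "u \<in> vertices n V" using inc_forestD(1)[OF F u] by auto
    then obtain k r where "is_root (vertices n V) E r" "(r, u) \<in> E ^^ k"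
      using less.IH[of u] inc_forest_rank_less[OF F r_into_trancl[OF u]] by blast
    then show ?thesis using u by (metis relpow_Suc_I)
  qed
qed

lemma height_root: "is_root W E r \<Longrightarrow> height W E r = 0"
  unfolding height_def by (rule Least_eq_0) auto

text \<open>As u is the only parent of v, paths of length k + 1 into v correspond to paths of length
  k into u; length 0 is excluded because v is not a root.\<close>

lemma height_edge:
  assumes F: "inc_forest n V E" and uv: "(u, v) \<in> E"
  shows "height (vertices n V) E v = Suc (height (vertices n V) E u)"
proof -
  let ?P = "\<lambda>v k. \<exists>r. is_root (vertices n V) E r \<and> (r, v) \<in> E ^^ k"
  have Suc: "?P v (Suc k) \<longleftrightarrow> ?P u k" for k
    using uv inc_forestD(3)[OF F] by (metis relpow_Suc_E relpow_Suc_I)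
  have "u \<in> vertices n V" using inc_forestD(1)[OF F uv] by auto
  then obtain k where "?P v (Suc k)" using inc_forest_root_reaches[OF F] Suc by blast
  moreover have "\<not> ?P v 0" using uv by (auto simp: is_root_def)
  ultimately have "(LEAST k. ?P v k) = Suc (LEAST k. ?P v (Suc k))"
    by (rule Least_Suc)
  then show ?thesis
    unfolding height_def Suc .
qed

text \<open>The two rules determine H by induction on the rank, and the height obeys the same rules.
  Heights after a modification of the forest can thus be guessed and verified without handling
  paths.\<close>

lemma height_eqI:
  assumes F: "inc_forest n V E" and v: "v \<in> vertices n V"
    and root: "\<And>r. is_root (vertices n V) E r \<Longrightarrow> H r = 0"
    and edge: "\<And>u w. (u, w) \<in> E \<Longrightarrow> H w = Suc (H u)"
  shows "height (vertices n V) E v = H v"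
  using v
proof (induction v rule: measure_induct_rule[where f = "case_sum id (\<lambda>_. Suc n)"])
  case (less v)
  show ?case
  proof (cases "is_root (vertices n V) E v")
    case True
    then show ?thesis using root height_root by metis
  next
    case False
    then obtain u where u: "(u, v) \<in> E" using less.prems by (auto simp: is_root_def)
    then have "u \<in> vertices n V" using inc_forestD(1)[OF F u] by auto
    then show ?thesis
      using less.IH[of u] inc_forest_rank_less[OF F r_into_trancl[OF u]] edge[OF u]
        height_edge[OF F u] by simp
  qed
qed

text \<open>Labels start at 1 or more and grow at each step down. For the vertex n + 1 this bounds
  the height by n, which is the range of the index i in the recurrence.\<close>

lemma height_less_label:
  assumes F: "inc_forest n V E" and "j \<in> {1..n}"
  shows "height (vertices n V) E (Inl j) < j"
  using assms(2)
proof (induction j rule: less_induct)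
  case (less j)
  show ?case
  proof (cases "is_root (vertices n V) E (Inl j)")
    case True
    then show ?thesis using less.prems by (simp add: height_root)
  next
    case False
    then obtain u where u: "(u, Inl j) \<in> E" using less.prems by (auto simp: is_root_def)
    then obtain i where i: "u = Inl i" "i \<in> {1..n}" using inc_forestD(1)[OF F u] by blast
    then have "i < j" using inc_forestD(4)[OF F] u by blast
    then show ?thesis using less.IH[of i] i height_edge[OF F u] by simp
  qed
qed

text \<open>The parent of a leaf has a label at most n and therefore height below n. So no forest
  exists if some leaf is required to lie outside this range.\<close>

lemma leaf_height_range:
  assumes "E \<in> increasing_forests n V \<kappa>" "v \<in> V"
  shows "\<kappa> v \<in> {1..n}"
proof -
  have F: "inc_forest n V E" and h: "height (vertices n V) E (Inr v) = \<kappa> v"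
    using assms by (auto simp: increasing_forests_iff)
  obtain u where u: "(u, Inr v) \<in> E" using assms by (auto simp: increasing_forests_iff)
  then obtain i where i: "u = Inl i" "i \<in> {1..n}" using inc_forestD(1)[OF F u] by blast
  then show ?thesis using height_less_label[OF F i(2)] h height_edge[OF F u] by simp
qed

lemma finite_increasing_forests:
  assumes "finite V"
  shows "finite (increasing_forests n V \<kappa>)"
proof (rule finite_subset)
  show "increasing_forests n V \<kappa> \<subseteq> Pow (Inl ` {1..n} \<times> vertices n V)"
    by (auto simp: increasing_forests_iff inc_forest_def)
  show "finite (Pow (Inl ` {1..n} \<times> vertices n V))"
    using assms by (simp add: vertices_def)
qed


section \<open>Removing the largest internal vertex\<close>

context
  fixes n i :: nat and V S :: "'v set" and s :: 'v and \<kappa> :: "'v \<Rightarrow> nat"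
  assumes s: "s \<notin> V" and S: "S \<subseteq> {v \<in> V. \<kappa> v = Suc i}"
begin

text \<open>One block of the forests with n + 1 internal vertices, given by the pair (i, S). The
  assumption on \<open>S\<close> reflects that children of a vertex at height i have height i +
  1.\<close>

definition peeled :: "((nat + 'v) \<times> (nat + 'v)) set set" where
  "peeled = {E \<in> increasing_forests (Suc n) V \<kappa>.
     height (vertices (Suc n) V) E (Inl (Suc n)) = i \<and> children E (Inl (Suc n)) = Inr ` S}"

text \<open>The leaf \<open>s\<close> takes the place of the vertex \<open>n + 1\<close> at height \<open>i\<close>; when \<open>n + 1\<close> is a root
  (\<open>i = 0\<close>) its tree, consisting of \<open>n + 1\<close> and the leaves in \<open>S\<close>, disappears altogether.\<close>

definition peeled_leaves :: "'v set" where
  "peeled_leaves = (if i = 0 then V - S else insert s (V - S))"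

text \<open>An edge into \<open>Inr s\<close> stands for the former edge into n + 1, so
  \<open>peel\<close> renames that target while dropping all edges out of n + 1;
  \<open>unpeel\<close> reverses both changes.\<close>

definition peel :: "((nat + 'v) \<times> (nat + 'v)) set \<Rightarrow> ((nat + 'v) \<times> (nat + 'v)) set" where
  "peel E = {(a, b). a \<noteq> Inl (Suc n) \<and> b \<noteq> Inl (Suc n) \<and>
     (a, if b = Inr s then Inl (Suc n) else b) \<in> E}"

definition unpeel :: "((nat + 'v) \<times> (nat + 'v)) set \<Rightarrow> ((nat + 'v) \<times> (nat + 'v)) set" where
  "unpeel E = {(a, b). b \<noteq> Inr s \<and> (a, if b = Inl (Suc n) then Inr s else b) \<in> E} \<union>
     {Inl (Suc n)} \<times> Inr ` S"

lemma peeled_leaves_iff: "v \<in> peeled_leaves \<longleftrightarrow> v \<in> V - S \<or> i \<noteq> 0 \<and> v = s"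
  by (auto simp: peeled_leaves_def)

text \<open>Renaming s back to n + 1 embeds the smaller forest into \<open>E\<close> and preserves
  heights and the numbers of children of the vertices 1 to n. The weights then differ only in the
  factor of the vertex n + 1.\<close>

lemma
  assumes E: "E \<in> peeled"
  shows peel_in_forests: "peel E \<in> increasing_forests n peeled_leaves (\<kappa>(s := i))" (is ?T1)
    and unpeel_peel: "unpeel (peel E) = E" (is ?T2)
    and peel_weight: "forest_weight \<phi> (Suc n) V E =
      qconst (\<phi> (card S)) * qvar i * forest_weight \<phi> n peeled_leaves (peel E)" (is ?T3)
proof -
  let ?W = "vertices (Suc n) V" and ?W' = "vertices n peeled_leaves" and ?N = "Inl (Suc n)"
  let ?h = "height ?W E" and ?\<tau> = "\<lambda>b. if b = Inr s then ?N else b"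
  have F: "inc_forest (Suc n) V E" and hN: "?h ?N = i" and cN: "children E ?N = Inr ` S"
    and leaf: "\<And>v. v \<in> V \<Longrightarrow> Inr v \<in> Range E" and hleaf: "\<And>v. v \<in> V \<Longrightarrow> ?h (Inr v) = \<kappa> v"
    using E by (auto simp: peeled_def increasing_forests_iff)
  have N_iff: "(?N, b) \<in> E \<longleftrightarrow> b \<in> Inr ` S" for b
    using cN by (auto simp: children_def)
  have src: "\<exists>j. u = Inl j \<and> 1 \<le> j \<and> j \<le> Suc n" if "(u, w) \<in> E" for u w
    using inc_forestD(1)[OF F that] by auto
  have tgt: "\<And>u w. (u, w) \<in> E \<Longrightarrow> w \<in> ?W"
    by (rule inc_forestD(2)[OF F])
  have mono: "j < k" if "(u, w) \<in> E" "u = Inl j" "w = Inl k" for u w j k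
    using inc_forestD(4)[OF F] that by simp
  have ucl: "\<And>u u' w. (u, w) \<in> E \<Longrightarrow> (u', w) \<in> E \<Longrightarrow> u = u'"
    by (rule inc_forestD(3)[OF F])
  have SV: "S \<subseteq> V" using S by blast
  \<comment> \<open>Since s is fresh, the renaming \<open>?\<tau>\<close> merges no two
    targets.\<close>
  have sE: "(a, Inr s) \<notin> E" for a
    using tgt[of a "Inr s"] s by auto
  have peel_iff: "(a, b) \<in> peel E \<longleftrightarrow> a \<noteq> ?N \<and> b \<noteq> ?N \<and> (a, ?\<tau> b) \<in> E" for a b
    by (simp add: peel_def)
  \<comment> \<open>The vertex n + 1 is a root exactly when i = 0, in agreement with the case
    distinction in \<open>peeled_leaves\<close>.\<close>
  have parentN: "i \<noteq> 0" if "(a, ?N) \<in> E" for a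
    using height_edge[OF F that] hN by simp
  have parentN': "\<exists>a. (a, ?N) \<in> E" if "i \<noteq> 0"
    using that hN height_root[of ?W E ?N] by (auto simp: is_root_def)
  have F': "inc_forest n peeled_leaves (peel E)"
    unfolding inc_forest_def
  proof (intro conjI allI impI subrelI)
    fix a b assume ab: "(a, b) \<in> peel E"
    then have *: "a \<noteq> ?N" "b \<noteq> ?N" "(a, ?\<tau> b) \<in> E" by (simp_all add: peel_iff)
    obtain j where j: "a = Inl j" "1 \<le> j" "j \<le> Suc n" using src[OF *(3)] by blast
    have "b \<in> ?W'"
    proof (cases b)
      case (Inl k)
      then show ?thesis using * tgt[of a b] by auto
    next
      case (Inr v)
      show ?thesis
      proof (cases "v = s")
        case True
        then show ?thesis using Inr * parentN by (simp add: peeled_leaves_iff)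
      next
        case False
        then have e: "(a, Inr v) \<in> E" using * Inr by simp
        then have "v \<in> V" using tgt[OF e] by simp
        moreover have "v \<notin> S" using ucl[OF e, of ?N] *(1) by (auto simp: N_iff)
        ultimately show ?thesis using Inr by (simp add: peeled_leaves_iff)
      qed
    qed
    then show "(a, b) \<in> Inl ` {1..n} \<times> ?W'" using j *(1) by (auto simp: le_Suc_eq)
  next
    fix u u' v assume "(u, v) \<in> peel E \<and> (u', v) \<in> peel E"
    then show "u = u'" using ucl by (meson peel_iff)
  next
    fix j k assume "(Inl j, Inl k) \<in> peel E"
    then show "j < k" using mono by (simp add: peel_iff)
  qed
  \<comment> \<open>The edges lost are those out of n + 1, and they end in \<open>S\<close>, whose
    leaves are no longer vertices. So no new roots arise and the heights carry over along
    \<open>?\<tau>\<close>.\<close>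
  have hpeel: "height ?W' (peel E) b = ?h (?\<tau> b)" if "b \<in> ?W'" for b
  proof (rule height_eqI[OF F' that])
    fix r assume r: "is_root ?W' (peel E) r"
    have "r \<noteq> ?N" using r by (auto simp: is_root_def)
    have "(a, ?\<tau> r) \<notin> E" for a
    proof
      assume a: "(a, ?\<tau> r) \<in> E"
      then have "a = ?N" using r \<open>r \<noteq> ?N\<close> by (auto simp: is_root_def peel_iff)
      then have "?\<tau> r \<in> Inr ` S" using a by (simp add: N_iff)
      then show False using r s SV by (auto simp: is_root_def peeled_leaves_iff split: if_splits)
    qed
    moreover have "?\<tau> r \<in> ?W"
      using r by (cases r) (auto simp: is_root_def peeled_leaves_iff)
    ultimately have "is_root ?W E (?\<tau> r)" by (auto simp: is_root_def)
    then show "?h (?\<tau> r) = 0" by (rule height_root)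
  next
    fix u w assume uw: "(u, w) \<in> peel E"
    then have "(u, ?\<tau> w) \<in> E" "?\<tau> u = u" using src[of u] by (auto simp: peel_iff)
    then show "?h (?\<tau> w) = Suc (?h (?\<tau> u))" using height_edge[OF F] by simp
  qed
  have Rng: "Inr v \<in> Range (peel E)" if v: "v \<in> peeled_leaves" for v
  proof (cases "v = s")
    case True
    then have "i \<noteq> 0" using v s by (auto simp: peeled_leaves_iff)
    then obtain a where a: "(a, ?N) \<in> E" using parentN' by blast
    then have "a \<noteq> ?N" using mono by blast
    then have "(a, Inr v) \<in> peel E" using a True by (simp add: peel_iff)
    then show ?thesis by blast
  next
    case False
    then have "v \<in> V" "v \<notin> S" using v by (auto simp: peeled_leaves_iff)
    then obtain a where a: "(a, Inr v) \<in> E" using leaf by blast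
    then have "a \<noteq> ?N" using \<open>v \<notin> S\<close> by (auto simp: N_iff)
    then have "(a, Inr v) \<in> peel E" using a False by (simp add: peel_iff)
    then show ?thesis by blast
  qed
  have "height ?W' (peel E) (Inr v) = (\<kappa>(s := i)) v" if v: "v \<in> peeled_leaves" for v
  proof (cases "v = s")
    case True
    then show ?thesis using hpeel[of "Inr v"] v hN by simp
  next
    case False
    then have "v \<in> V" using v by (simp add: peeled_leaves_iff)
    then show ?thesis using hpeel[of "Inr v"] v False hleaf by simp
  qed
  then show ?T1
    unfolding increasing_forests_iff using F' Rng by blast
  show ?T2
  proof (rule set_eqI)
    fix e :: "(nat + 'v) \<times> (nat + 'v)"
    obtain a b where e: "e = (a, b)" by (cases e)
    have "(a, b) \<in> unpeel (peel E) \<longleftrightarrow> (a, b) \<in> E"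
    proof (cases "a = ?N")
      case True
      then show ?thesis by (auto simp: unpeel_def peel_iff N_iff)
    next
      case False
      then show ?thesis using sE by (auto simp: unpeel_def peel_iff)
    qed
    then show "e \<in> unpeel (peel E) \<longleftrightarrow> e \<in> E" by (simp add: e)
  qed
  have "card (children E (Inl j)) = card (children (peel E) (Inl j))" if j: "j \<in> {1..n}" for j
  proof -
    have "children E (Inl j) = ?\<tau> ` children (peel E) (Inl j)"
    proof (rule set_eqI)
      fix b
      show "b \<in> children E (Inl j) \<longleftrightarrow> b \<in> ?\<tau> ` children (peel E) (Inl j)"
        using sE j by (cases "b = ?N") (auto simp: children_def peel_iff image_iff)
    qed
    moreover have "inj_on ?\<tau> (children (peel E) (Inl j))"
      by (auto simp: inj_on_def children_def peel_iff)
    ultimately show ?thesis by (simp only: card_image)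
  qed
  moreover have "?h (Inl j) = height ?W' (peel E) (Inl j)" if j: "j \<in> {1..n}" for j
    using hpeel[of "Inl j"] j by simp
  moreover have "card (children E ?N) = card S"
    using cN by (simp add: card_image)
  \<comment> \<open>The product over 1 to n + 1 loses its last factor, which is \<phi>[|S|]
    q_i.\<close>
  ultimately show ?T3
    using hN unfolding forest_weight_def
    by (simp add: prod.cl_ivl_Suc mult.commute)
qed

text \<open>Hanging the leaves of \<open>S\<close> below the restored vertex n + 1 creates no
  conflict: neither n + 1 nor a leaf in \<open>S\<close> is a vertex of \<open>E\<close>.\<close>

lemma
  assumes E: "E \<in> increasing_forests n peeled_leaves (\<kappa>(s := i))"
  shows unpeel_in_peeled: "unpeel E \<in> peeled" (is ?T1)
    and peel_unpeel: "peel (unpeel E) = E" (is ?T2)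
proof -
  let ?W = "vertices (Suc n) V" and ?W' = "vertices n peeled_leaves" and ?N = "Inl (Suc n)"
  let ?h = "height ?W' E" and ?\<sigma> = "\<lambda>b. if b = ?N then Inr s else b"
  have F: "inc_forest n peeled_leaves E"
    and leaf: "\<And>v. v \<in> peeled_leaves \<Longrightarrow> Inr v \<in> Range E"
    and hleaf: "\<And>v. v \<in> peeled_leaves \<Longrightarrow> ?h (Inr v) = (\<kappa>(s := i)) v"
    using E by (auto simp: increasing_forests_iff)
  have src: "\<exists>j. u = Inl j \<and> 1 \<le> j \<and> j \<le> n" if "(u, w) \<in> E" for u w
    using inc_forestD(1)[OF F that] by auto
  have tgt: "\<And>u w. (u, w) \<in> E \<Longrightarrow> w \<in> ?W'"
    by (rule inc_forestD(2)[OF F])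
  have mono: "j < k" if "(u, w) \<in> E" "u = Inl j" "w = Inl k" for u w j k
    using inc_forestD(4)[OF F] that by simp
  have ucl: "\<And>u u' w. (u, w) \<in> E \<Longrightarrow> (u', w) \<in> E \<Longrightarrow> u = u'"
    by (rule inc_forestD(3)[OF F])
  have SV: "S \<subseteq> V" using S by blast
  have NE: "(?N, b) \<notin> E" "(a, ?N) \<notin> E" for a b
    using src[of ?N b] tgt[of a ?N] by auto
  have SE: "(a, Inr v) \<notin> E" if "v \<in> S" for a v
    using tgt[of a "Inr v"] that SV s by (auto simp: peeled_leaves_iff)
  have unpeel_iff: "(a, b) \<in> unpeel E \<longleftrightarrow>
      b \<noteq> Inr s \<and> (a, ?\<sigma> b) \<in> E \<or> a = ?N \<and> b \<in> Inr ` S" for a b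
    by (auto simp: unpeel_def)
  have F': "inc_forest (Suc n) V (unpeel E)"
    unfolding inc_forest_def
  proof (intro conjI allI impI subrelI)
    fix a b assume ab: "(a, b) \<in> unpeel E"
    then consider "b \<noteq> Inr s" "(a, ?\<sigma> b) \<in> E" | "a = ?N" "b \<in> Inr ` S"
      by (auto simp: unpeel_iff)
    then show "(a, b) \<in> Inl ` {1..Suc n} \<times> ?W"
    proof cases
      case 1
      have "b \<in> ?W"
        using tgt[OF 1(2)] 1(1) by (cases b) (auto simp: peeled_leaves_iff split: if_splits)
      then show ?thesis using src[OF 1(2)] by auto
    next
      case 2
      then show ?thesis using SV by auto
    qed
  next
    fix u u' v assume "(u, v) \<in> unpeel E \<and> (u', v) \<in> unpeel E"
    \<comment> \<open>Leaves in \<open>S\<close> have no parent in \<open>E\<close>, so the edge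
      from n + 1 is their only one; elsewhere uniqueness is inherited through the renaming
      \<open>?\<sigma>\<close>.\<close>
    then show "u = u'" using ucl[of u "?\<sigma> v" u'] SE by (auto simp: unpeel_iff)
  next
    fix j k assume jk: "(Inl j, Inl k) \<in> unpeel E"
    then have e: "(Inl j, ?\<sigma> (Inl k)) \<in> E" by (auto simp: unpeel_iff)
    show "j < k"
    proof (cases "k = Suc n")
      case True
      then show ?thesis using src[OF e] by auto
    next
      case False
      then show ?thesis using mono[OF e] by simp
    qed
  qed
  \<comment> \<open>The expected heights: i + 1 on \<open>S\<close>, i at n + 1, and unchanged
    elsewhere.\<close>
  let ?H = "\<lambda>b. if b \<in> Inr ` S then Suc i else if b = ?N then i else ?h b"
  have hun: "height ?W (unpeel E) b = ?H b" if "b \<in> ?W" for b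
  proof (rule height_eqI[OF F' that])
    fix r assume r: "is_root ?W (unpeel E) r"
    then have nS: "r \<notin> Inr ` S" by (auto simp: is_root_def unpeel_iff)
    show "?H r = 0"
    proof (cases "r = ?N")
      case True
      \<comment> \<open>If i were positive, s would be a leaf of \<open>E\<close> and have a parent,
        which would become a parent of n + 1.\<close>
      have "Inr s \<notin> Range E" using r True by (auto simp: is_root_def unpeel_iff)
      then have "i = 0" using leaf[of s] by (auto simp: peeled_leaves_iff)
      then show ?thesis using nS True by simp
    next
      case False
      have "r \<noteq> Inr s" using r s by (auto simp: is_root_def)
      have "is_root ?W' E r"
        using r nS False \<open>r \<noteq> Inr s\<close>
        by (cases r) (auto simp: is_root_def unpeel_iff peeled_leaves_iff le_Suc_eq)
      then show ?thesis using nS False by (simp add: height_root)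
    qed
  next
    fix u w assume "(u, w) \<in> unpeel E"
    then consider "w \<noteq> Inr s" "(u, ?\<sigma> w) \<in> E" | "u = ?N" "w \<in> Inr ` S"
      by (auto simp: unpeel_iff)
    then show "?H w = Suc (?H u)"
    proof cases
      case 1
      have "w \<notin> Inr ` S" using 1 SE by auto
      moreover have "?H u = ?h u" using src[OF 1(2)] by auto
      moreover have "?h (?\<sigma> w) = Suc (?h u)" by (rule height_edge[OF F 1(2)])
      \<comment> \<open>The update of \<kappa> at s places the substitute leaf at the height
        intended for n + 1.\<close>
      moreover have "?h (Inr s) = i" if "w = ?N"
        using hleaf[of s] tgt[OF 1(2)] that by simp
      ultimately show ?thesis by (cases "w = ?N") auto
    next
      case 2
      then show ?thesis by auto
    qed
  qed
  have "Inr v \<in> Range (unpeel E)" if v: "v \<in> V" for v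
  proof (cases "v \<in> S")
    case True
    then show ?thesis by (auto simp: unpeel_iff)
  next
    case False
    then obtain a where "(a, Inr v) \<in> E" using leaf[of v] v by (auto simp: peeled_leaves_iff)
    then have "(a, Inr v) \<in> unpeel E" using v s by (auto simp: unpeel_iff)
    then show ?thesis by blast
  qed
  moreover have "height ?W (unpeel E) (Inr v) = \<kappa> v" if v: "v \<in> V" for v
  proof (cases "v \<in> S")
    case True
    then show ?thesis using hun[of "Inr v"] v S by auto
  next
    case False
    then have "?h (Inr v) = (\<kappa>(s := i)) v" using hleaf[of v] v by (simp add: peeled_leaves_iff)
    moreover have "v \<noteq> s" using v s by blast
    ultimately show ?thesis using hun[of "Inr v"] v False by auto
  qed
  moreover have "height ?W (unpeel E) ?N = i"
    using hun[of ?N] by auto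
  moreover have "children (unpeel E) ?N = Inr ` S"
    using NE by (auto simp: children_def unpeel_iff)
  ultimately show ?T1
    using F' by (simp add: peeled_def increasing_forests_iff)
  show ?T2
  proof (rule set_eqI)
    fix e :: "(nat + 'v) \<times> (nat + 'v)"
    obtain a b where e: "e = (a, b)" by (cases e)
    have "(a, b) \<in> peel (unpeel E) \<longleftrightarrow> (a, b) \<in> E"
      using NE by (cases "a = ?N"; cases "b = ?N") (auto simp: peel_def unpeel_iff)
    then show "e \<in> peel (unpeel E) \<longleftrightarrow> e \<in> E" by (simp add: e)
  qed
qed

lemma sum_peeled:
  "(\<Sum>E\<in>peeled. forest_weight \<phi> (Suc n) V E) =
     qconst (\<phi> (card S)) * qvar i * forest_sum \<phi> n peeled_leaves (\<kappa>(s := i))"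
  unfolding forest_sum_def sum_distrib_left
  by (rule sum.reindex_bij_witness[where i = unpeel and j = peel])
    (simp_all add: peel_in_forests unpeel_peel peel_weight unpeel_in_peeled peel_unpeel)

end

section \<open>Summation over the height and the children of the largest internal vertex\<close>

text \<open>The pair of height and child set of n + 1 partitions all forests into the blocks
  \<open>peeled\<close>, and \<open>sum_peeled\<close> evaluates each block, empty blocks
  included.\<close>

lemma forest_sum_Suc:
  assumes fin: "finite V" and s: "s \<notin> V"
  shows "forest_sum \<phi> (Suc n) V \<kappa> =
    (\<Sum>i\<le>n. \<Sum>S\<in>Pow {v \<in> V. \<kappa> v = Suc i}. qconst (\<phi> (card S)) * qvar i *
       forest_sum \<phi> n (if i = 0 then V - S else insert s (V - S)) (\<kappa>(s := i)))"
proof -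
  let ?A = "increasing_forests (Suc n) V \<kappa>" and ?N = "Inl (Suc n)" and ?W = "vertices (Suc n) V"
  let ?I = "SIGMA i:{..n}. Pow {v \<in> V. \<kappa> v = Suc i}"
  let ?g = "\<lambda>E. (height ?W E ?N, {v. (?N, Inr v) \<in> E})"
  have img: "?g E \<in> ?I \<and> children E ?N = Inr ` snd (?g E)" if E: "E \<in> ?A" for E
  proof -
    have F: "inc_forest (Suc n) V E" using E by (simp add: increasing_forests_iff)
    \<comment> \<open>An internal child would need a label above n + 1, so every child is a
      leaf.\<close>
    have "b \<in> Inr ` snd (?g E)" if "(?N, b) \<in> E" for b
      using that inc_forestD(2)[OF F that] inc_forestD(4)[OF F, of "Suc n"] by (cases b) force+
    then have c: "children E ?N = Inr ` snd (?g E)" by (auto simp: children_def)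
    have "v \<in> V \<and> \<kappa> v = Suc (height ?W E ?N)" if v: "(?N, Inr v) \<in> E" for v
    proof -
      have "v \<in> V" using inc_forestD(2)[OF F v] by simp
      then show ?thesis using E height_edge[OF F v] by (auto simp: increasing_forests_iff)
    qed
    moreover have "height ?W E ?N \<le> n" using height_less_label[OF F, of "Suc n"] by simp
    ultimately show ?thesis using c by auto
  qed
  have "forest_sum \<phi> (Suc n) V \<kappa> =
      (\<Sum>p\<in>?I. \<Sum>E\<in>{E \<in> ?A. ?g E = p}. forest_weight \<phi> (Suc n) V E)"
    unfolding forest_sum_def
    by (rule sum.group[symmetric])
      (use fin img in \<open>auto intro!: finite_SigmaI finite_increasing_forests\<close>)
  also have "\<dots> = (\<Sum>(i, S)\<in>?I. qconst (\<phi> (card S)) * qvar i *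
       forest_sum \<phi> n (if i = 0 then V - S else insert s (V - S)) (\<kappa>(s := i)))"
  proof (rule sum.cong[OF refl])
    fix p assume "p \<in> ?I"
    then obtain i S where p: "p = (i, S)" and S: "S \<subseteq> {v \<in> V. \<kappa> v = Suc i}" by auto
    have "{E \<in> ?A. ?g E = p} = peeled n i V S \<kappa>"
    proof (intro set_eqI iffI)
      fix E assume "E \<in> {E \<in> ?A. ?g E = p}"
      then show "E \<in> peeled n i V S \<kappa>" using img[of E] by (simp add: peeled_def[OF s S] p)
    next
      fix E assume "E \<in> peeled n i V S \<kappa>"
      then show "E \<in> {E \<in> ?A. ?g E = p}"
        by (auto simp: peeled_def[OF s S] p children_def)
    qed
    then show "(\<Sum>E\<in>{E \<in> ?A. ?g E = p}. forest_weight \<phi> (Suc n) V E) =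
        (case p of (i, S) \<Rightarrow> qconst (\<phi> (card S)) * qvar i *
          forest_sum \<phi> n (if i = 0 then V - S else insert s (V - S)) (\<kappa>(s := i)))"
      using sum_peeled[OF s S, of \<phi> n] by (simp add: p peeled_leaves_def[OF s S])
  qed
  also have "\<dots> = (\<Sum>i\<le>n. \<Sum>S\<in>Pow {v \<in> V. \<kappa> v = Suc i}. qconst (\<phi> (card S)) * qvar i *
       forest_sum \<phi> n (if i = 0 then V - S else insert s (V - S)) (\<kappa>(s := i)))"
    by (subst sum.Sigma) (use fin in auto)
  finally show ?thesis .
qed


section \<open>The generating series\<close>

lemma rat_embedding_mult: "rat_embedding \<iota> \<Longrightarrow> \<iota> (a * b) = \<iota> a * \<iota> b"
  and rat_embedding_1: "rat_embedding \<iota> \<Longrightarrow> \<iota> 1 = 1"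
  by (simp_all add: rat_embedding_def)

lemma rat_embedding_of_nat:
  assumes "rat_embedding \<iota>"
  shows "\<iota> (of_nat k) = of_nat k"
proof (induction k)
  case 0
  have "\<iota> (0 + 0) = \<iota> 0 + \<iota> 0" using assms unfolding rat_embedding_def by blast
  then show ?case by simp
next
  case (Suc k)
  then show ?case using assms by (simp add: rat_embedding_def)
qed

lemma qconst_mult: "qconst (a * b) = qconst a * qconst b"
  by (simp add: qconst_def mult_single)

lemma qconst_of_nat: "qconst (of_nat k) = of_nat k"
  by (simp add: qconst_def)

lemma mps_coeff_0 [simp]: "mps_coeff 0 m = 0"
  and mps_coeff_add [simp]: "mps_coeff (f + g) m = mps_coeff f m + mps_coeff g m"
  by (simp_all add: zero_mps_def plus_mps_def)

lemma mps_coeff_sum: "mps_coeff (sum f A) m = (\<Sum>x\<in>A. mps_coeff (f x) m)"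
  by (induction A rule: infinite_finite_induct) simp_all

lemma mps_const_mult_coeff: "mps_coeff (mps_const c * g) m = c * mps_coeff g m"
proof -
  have "mps_coeff (mps_const c * g) m =
      (\<Sum>s\<in>splits m. if s = (0, m) then c * mps_coeff g m else 0)"
    unfolding times_mps_def mps_const_def mps_coeff_Abs
    by (rule sum.cong) (auto simp: splits_def split: if_splits)
  also have "\<dots> = c * mps_coeff g m"
    by (subst sum.delta) (use finite_splits[of m] in \<open>auto simp: splits_def\<close>)
  finally show ?thesis .
qed

text \<open>The first factor contains only powers of x_j, so among all splittings of m only those
  with first part x_j^t contribute, one for each t up to the exponent of x_j in m.\<close>

lemma fps_at_var_mult_coeff:
  "mps_coeff (fps_at_var f j * g) m =
     (\<Sum>t\<le>Poly_Mapping.lookup m j.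
        qconst (fps_nth f t) * mps_coeff g (m - Poly_Mapping.single j t))"
proof -
  let ?h = "\<lambda>t. (Poly_Mapping.single j t, m - Poly_Mapping.single j t)"
  let ?T = "{..Poly_Mapping.lookup m j}"
  have single: "a = Poly_Mapping.single j (Poly_Mapping.lookup a j)"
    if "Poly_Mapping.keys a \<subseteq> {j}" for a :: monom
    by (rule poly_mapping_eqI) (use that in \<open>auto simp: lookup_single when_def in_keys_iff\<close>)
  have splits: "?h t \<in> splits m" if "t \<in> ?T" for t
    unfolding splits_def
    using that by (auto intro!: poly_mapping_eqI simp: lookup_add lookup_minus lookup_single when_def)
  have "mps_coeff (fps_at_var f j * g) m =
      (\<Sum>(a, b)\<in>?h ` ?T. mps_coeff (fps_at_var f j) a * mps_coeff g b)"
    unfolding times_mps_def mps_coeff_Abs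
  proof (rule sum.mono_neutral_right)
    show "\<forall>p\<in>splits m - ?h ` ?T. (case p of (a, b) \<Rightarrow> mps_coeff (fps_at_var f j) a * mps_coeff g b) = 0"
    proof clarify
      fix a b assume ab: "(a, b) \<in> splits m" "(a, b) \<notin> ?h ` ?T"
      have "\<not> Poly_Mapping.keys a \<subseteq> {j}"
      proof
        assume "Poly_Mapping.keys a \<subseteq> {j}"
        then obtain t where a: "a = Poly_Mapping.single j t" using single by blast
        have m: "a + b = m" using ab(1) by (simp add: splits_def)
        then have "(a, b) = ?h t" using a by auto
        moreover have "t \<in> ?T" using m a by (auto simp: lookup_add)
        ultimately show False using ab(2) by (metis (no_types, lifting) imageI)
      qed
      then show "mps_coeff (fps_at_var f j) a * mps_coeff g b = 0"
        by (simp add: fps_at_var_def)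
    qed
  qed (use splits in auto)
  also have "\<dots> = (\<Sum>t\<in>?T. mps_coeff (fps_at_var f j) (Poly_Mapping.single j t) *
      mps_coeff g (m - Poly_Mapping.single j t))"
    by (subst sum.reindex) (auto simp: inj_on_def dest: arg_cong[where f = "\<lambda>p. Poly_Mapping.lookup p j"])
  also have "\<dots> = (\<Sum>t\<in>?T. qconst (fps_nth f t) * mps_coeff g (m - Poly_Mapping.single j t))"
    by (rule sum.cong) (auto simp: fps_at_var_def)
  finally show ?thesis .
qed

section \<open>Coefficients of the series and its derivatives as forest sums\<close>

text \<open>The recurrence compares series in n and in n + 1 variables, so the formula for
  coefficients is needed with a larger bound N. If a variable beyond n occurs in k, both sides
  vanish.\<close>

lemma Y_series_coeff_ge:
  assumes fin: "finite V" and N: "n \<le> N" and range: "\<kappa> ` V \<subseteq> {1..N}"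
    and card: "\<And>i. i \<in> {1..N} \<Longrightarrow> card {v \<in> V. \<kappa> v = i} = Poly_Mapping.lookup k i"
    and supp: "Poly_Mapping.keys k \<subseteq> {1..N}"
  shows "mps_coeff (Y_series \<iota> \<phi> n) k =
    qconst (\<iota> (1 / (\<Prod>i\<in>{1..N}. fact (Poly_Mapping.lookup k i)))) * forest_sum \<phi> n V \<kappa>"
proof (cases "Poly_Mapping.keys k \<subseteq> {1..n}")
  case True
  have "\<kappa> v \<in> {1..n}" if v: "v \<in> V" for v
  proof (rule ccontr)
    assume "\<kappa> v \<notin> {1..n}"
    then have "Poly_Mapping.lookup k (\<kappa> v) = 0" using True by (auto simp: in_keys_iff)
    moreover have "\<kappa> v \<in> {1..N}" using range v by blast
    ultimately have "{w \<in> V. \<kappa> w = \<kappa> v} = {}" using card[of "\<kappa> v"] fin by simp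
    then show False using v by blast
  qed
  then have range': "\<kappa> ` V \<subseteq> {1..n}" by blast
  have "Poly_Mapping.lookup k i = 0" if "i \<notin> {1..n}" for i
    using True that by (auto simp: in_keys_iff)
  then have "(\<Prod>i\<in>{1..N}. fact (Poly_Mapping.lookup k i)) =
      (\<Prod>i\<in>{1..n}. fact (Poly_Mapping.lookup k i) :: rat)"
    by (intro prod.mono_neutral_right) (use N in simp_all)
  then show ?thesis
    using Y_series_coeff[OF fin range' card True, of \<iota> \<phi>] N by simp
next
  case False
  then obtain i where i: "i \<in> Poly_Mapping.keys k" "i \<notin> {1..n}" by blast
  then have "i \<in> {1..N}" using supp by blast
  then have "card {v \<in> V. \<kappa> v = i} \<noteq> 0" using card i by (simp add: in_keys_iff)
  then obtain v where "v \<in> V" "\<kappa> v = i" by (metis (mono_tags, lifting) card.empty empty_Collect_eq)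
  \<comment> \<open>Some leaf would have to lie at a height that n internal vertices cannot
    provide.\<close>
  then have "increasing_forests n V \<kappa> = {}" using leaf_height_range[of _ n V \<kappa> v] i by blast
  then show ?thesis using False by (simp add: Y_series_def forest_sum_def)
qed

text \<open>With \<open>\<partial>\<^sub>0\<close> read as the identity, the term of the recurrence in which the largest vertex is a root
  takes the same form as the others.\<close>

definition mps_deriv_or_id :: "nat \<Rightarrow> 'a::comm_ring_1 mps \<Rightarrow> 'a mps" where
  "mps_deriv_or_id i f = (if i = 0 then f else mps_deriv i f)"

text \<open>For positive i the derivative reads the coefficient at k + e_i, which the extra leaf s
  at height i realizes; its factor k_i + 1 turns the reciprocal of (k + e_i)! into that of k!. For i
  = 0 no leaf is added and the update at s does not affect \<open>V\<close>.\<close>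

lemma mps_deriv_or_id_Y_coeff:
  assumes \<iota>: "rat_embedding \<iota>" and fin: "finite V" and s: "s \<notin> V" and i: "i \<le> n"
    and range: "\<kappa> ` V \<subseteq> {1..Suc n}"
    and card: "\<And>j. j \<in> {1..Suc n} \<Longrightarrow> card {v \<in> V. \<kappa> v = j} = Poly_Mapping.lookup k j"
    and supp: "Poly_Mapping.keys k \<subseteq> {1..Suc n}"
  shows "mps_coeff (mps_deriv_or_id i (Y_series \<iota> \<phi> n)) k =
    qconst (\<iota> (1 / (\<Prod>j\<in>{1..Suc n}. fact (Poly_Mapping.lookup k j)))) *
    forest_sum \<phi> n (if i = 0 then V else insert s V) (\<kappa>(s := i))"
proof (cases "i = 0")
  case True
  have "{v \<in> V. (\<kappa>(s := i)) v = j} = {v \<in> V. \<kappa> v = j}" for j using s by auto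
  moreover have "(\<kappa>(s := i)) ` V = \<kappa> ` V" using s by (intro image_cong) auto
  ultimately show ?thesis
    using Y_series_coeff_ge[OF fin, of n "Suc n" "\<kappa>(s := i)" k \<iota> \<phi>] range card supp True
    by (simp add: mps_deriv_or_id_def)
next
  case False
  let ?k = "k + Poly_Mapping.single i 1" and ?V = "insert s V" and ?\<kappa> = "\<kappa>(s := i)"
  have lk: "Poly_Mapping.lookup ?k j = Poly_Mapping.lookup k j + (if j = i then 1 else 0)" for j
    by (simp add: lookup_add lookup_single when_def)
  have fib: "{v \<in> ?V. ?\<kappa> v = j} = (if j = i then insert s {v \<in> V. \<kappa> v = j} else {v \<in> V. \<kappa> v = j})"
    for j using s by auto
  have card': "card {v \<in> ?V. ?\<kappa> v = j} = Poly_Mapping.lookup ?k j" if "j \<in> {1..Suc n}" for j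
    unfolding fib lk using card[OF that] fin s by (cases "j = i") auto
  have supp': "Poly_Mapping.keys ?k \<subseteq> {1..Suc n}"
  proof
    fix j assume "j \<in> Poly_Mapping.keys ?k"
    then have "j \<in> Poly_Mapping.keys k \<or> j = i" unfolding in_keys_iff lk by (simp split: if_splits)
    then show "j \<in> {1..Suc n}" using supp False i by auto
  qed
  have range': "?\<kappa> ` ?V \<subseteq> {1..Suc n}" using range False i by auto
  have iI: "i \<in> {1..Suc n}" using False i by simp
  let ?P = "\<lambda>k. \<Prod>j\<in>{1..Suc n}. fact (Poly_Mapping.lookup k j) :: rat"
  have "?P ?k = (\<Prod>j\<in>{1..Suc n}. fact (Poly_Mapping.lookup k j) *
      (if j = i then of_nat (Poly_Mapping.lookup k i + 1) else 1))"
    unfolding lk by (rule prod.cong) auto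
  also have "\<dots> = ?P k * of_nat (Poly_Mapping.lookup k i + 1)"
    using iI by (simp add: prod.distrib prod.delta del: prod.cl_ivl_Suc of_nat_add)
  finally have P: "of_nat (Poly_Mapping.lookup k i + 1) * (1 / ?P ?k) = 1 / ?P k"
    by (simp del: prod.cl_ivl_Suc of_nat_add)
  have "mps_coeff (mps_deriv_or_id i (Y_series \<iota> \<phi> n)) k =
      of_nat (Poly_Mapping.lookup k i + 1) * mps_coeff (Y_series \<iota> \<phi> n) ?k"
    using False by (simp add: mps_deriv_or_id_def mps_deriv_def)
  also have "mps_coeff (Y_series \<iota> \<phi> n) ?k = qconst (\<iota> (1 / ?P ?k)) * forest_sum \<phi> n ?V ?\<kappa>"
    by (rule Y_series_coeff_ge) (use fin range' card' supp' in auto)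
  also have "of_nat (Poly_Mapping.lookup k i + 1) * (qconst (\<iota> (1 / ?P ?k)) * forest_sum \<phi> n ?V ?\<kappa>) =
      qconst (\<iota> (of_nat (Poly_Mapping.lookup k i + 1) * (1 / ?P ?k))) * forest_sum \<phi> n ?V ?\<kappa>"
    unfolding rat_embedding_mult[OF \<iota>] rat_embedding_of_nat[OF \<iota>] qconst_mult qconst_of_nat
    by (simp only: mult.assoc)
  finally show ?thesis unfolding P using False by simp
qed

text \<open>A variable outside the range still divides the monomial k x_i at which the derivative
  reads its coefficient.\<close>

lemma mps_deriv_or_id_Y_coeff_eq_0:
  assumes "i \<le> n" "\<not> Poly_Mapping.keys k \<subseteq> {1..Suc n}"
  shows "mps_coeff (mps_deriv_or_id i (Y_series \<iota> \<phi> n)) k = 0"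
proof -
  obtain j where j: "j \<in> Poly_Mapping.keys k" "j \<notin> {1..Suc n}" using assms by blast
  then have "j \<in> Poly_Mapping.keys (k + Poly_Mapping.single i 1)"
    by (auto simp: in_keys_iff lookup_add)
  then have "\<not> Poly_Mapping.keys k \<subseteq> {1..n}"
    "\<not> Poly_Mapping.keys (k + Poly_Mapping.single i 1) \<subseteq> {1..n}"
    using j by force+
  then show ?thesis
    by (simp add: mps_deriv_or_id_def mps_deriv_def Y_series_def)
qed

section \<open>The recurrence by comparison of coefficients\<close>

lemma sum_Pow_card:
  fixes g :: "nat \<Rightarrow> 'a::comm_semiring_1"
  assumes "finite A"
  shows "(\<Sum>S\<in>Pow A. g (card S)) = (\<Sum>t\<le>card A. of_nat (card A choose t) * g t)"
proof -
  have "(\<Sum>S\<in>Pow A. g (card S)) = (\<Sum>t\<le>card A. \<Sum>S\<in>{S \<in> Pow A. card S = t}. g (card S))"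
    by (rule sum.group[symmetric]) (use assms in \<open>auto intro: card_mono\<close>)
  also have "\<dots> = (\<Sum>t\<le>card A. of_nat (card A choose t) * g t)"
    by (rule sum.cong) (use n_subsets[OF assms] in \<open>auto simp: Pow_def\<close>)
  finally show ?thesis .
qed

text \<open>In the coefficient at m, let c be the exponent of x_{i+1}. The c choose t subsets
  \<open>S\<close> of size t contribute equally, and together with the quotient (c - t)!/c! of the
  normalizing factorials they give the 1/t! in the exponential generating series of \<phi>.\<close>

lemma Y_series_Suc:
  assumes \<iota>: "rat_embedding \<iota>"
  shows "Y_series \<iota> \<phi> (Suc n) = (\<Sum>i\<le>n. fps_at_var (egf \<iota> \<phi>) (i + 1) * mps_const (qvar i) *
     mps_deriv_or_id i (Y_series \<iota> \<phi> n))"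
proof (rule mps_eqI)
  fix m :: monom
  let ?D = "\<lambda>i. mps_coeff (mps_deriv_or_id i (Y_series \<iota> \<phi> n))"
  let ?m = "\<lambda>i t. m - Poly_Mapping.single (Suc i) t"
  have R: "mps_coeff (\<Sum>i\<le>n. fps_at_var (egf \<iota> \<phi>) (i + 1) * mps_const (qvar i) *
      mps_deriv_or_id i (Y_series \<iota> \<phi> n)) m =
    (\<Sum>i\<le>n. \<Sum>t\<le>Poly_Mapping.lookup m (Suc i).
       qconst (\<phi> t * \<iota> (1 / fact t)) * (qvar i * ?D i (?m i t)))"
    by (simp add: mps_coeff_sum mult.assoc fps_at_var_mult_coeff mps_const_mult_coeff egf_def)
  have lm: "Poly_Mapping.lookup (?m i t) j =
      Poly_Mapping.lookup m j - (if j = Suc i then t else 0)" for i t j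
    by (simp add: lookup_minus lookup_single when_def)
  show "mps_coeff (Y_series \<iota> \<phi> (Suc n)) m =
    mps_coeff (\<Sum>i\<le>n. fps_at_var (egf \<iota> \<phi>) (i + 1) * mps_const (qvar i) *
      mps_deriv_or_id i (Y_series \<iota> \<phi> n)) m"
  proof (cases "Poly_Mapping.keys m \<subseteq> {1..Suc n}")
    case False
    then obtain j where j: "j \<in> Poly_Mapping.keys m" "j \<notin> {1..Suc n}" by blast
    have "?D i (?m i t) = 0" if "i \<le> n" for i t
    proof (rule mps_deriv_or_id_Y_coeff_eq_0[OF that])
      have "j \<in> Poly_Mapping.keys (?m i t)" using j that by (auto simp: in_keys_iff lm)
      then show "\<not> Poly_Mapping.keys (?m i t) \<subseteq> {1..Suc n}" using j by blast
    qed
    then show ?thesis using False unfolding R by (simp add: Y_series_def)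
  next
    case True
    \<comment> \<open>Leaves in \<open>leaf_set\<close> have first component at least 1, so (0, 0)
      is available as the fresh leaf s.\<close>
    let ?V = "leaf_set (Suc n) m" and ?s = "(0, 0) :: nat \<times> nat"
    let ?P = "\<lambda>k. \<Prod>j\<in>{1..Suc n}. fact (Poly_Mapping.lookup k j) :: rat"
    let ?F = "\<lambda>i S. forest_sum \<phi> n (if i = 0 then ?V - S else insert ?s (?V - S)) (fst(?s := i))"
    have fin: "finite ?V" and s: "?s \<notin> ?V" by (auto simp: leaf_set_def)
    have fib: "{v \<in> ?V. fst v = j} = {j} \<times> {..<Poly_Mapping.lookup m j}" if "j \<in> {1..Suc n}" for j
      using that by (auto simp: leaf_set_def)
    have "qconst (\<iota> (1 / ?P m)) *
        (\<Sum>S\<in>Pow {v \<in> ?V. fst v = Suc i}. qconst (\<phi> (card S)) * qvar i * ?F i S) =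
        (\<Sum>t\<le>Poly_Mapping.lookup m (Suc i).
           qconst (\<phi> t * \<iota> (1 / fact t)) * (qvar i * ?D i (?m i t)))"
      if i: "i \<le> n" for i
    proof -
      let ?A = "{v \<in> ?V. fst v = Suc i}" and ?c = "Poly_Mapping.lookup m (Suc i)"
      have A: "?A = {Suc i} \<times> {..<?c}" using fib i by simp
      have cardA: "card ?A = ?c" and finA: "finite ?A" unfolding A by simp_all
      \<comment> \<open>The common contribution of all \<open>S\<close> of size t; the factorial
        quotient compensates for normalizing by m - t e_{i+1} in place of m.\<close>
      define g where "g t = qconst (\<iota> (fact (?c - t) / fact ?c)) *
        (qconst (\<phi> t) * (qvar i * ?D i (?m i t)))" for t
      have summand: "qconst (\<iota> (1 / ?P m)) * (qconst (\<phi> (card S)) * qvar i * ?F i S) = g (card S)"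
        if S: "S \<subseteq> ?A" for S
      proof -
        define t where "t = card S"
        have finS: "finite S" using S finA by (rule finite_subset)
        have t: "t \<le> ?c" unfolding t_def using card_mono[OF finA S] cardA by simp
        \<comment> \<open>Deleting \<open>S\<close> lowers only the number of leaves at height i +
          1, so the remaining leaves realize the monomial \<open>?m i t\<close>.\<close>
        have "card {v \<in> ?V - S. fst v = j} = Poly_Mapping.lookup (?m i t) j"
          if j: "j \<in> {1..Suc n}" for j
        proof (cases "j = Suc i")
          case True
          then have "{v \<in> ?V - S. fst v = j} = ?A - S" by auto
          then show ?thesis using card_Diff_subset[OF finS S] cardA True by (simp add: lm t_def)
        next
          case False
          then have "{v \<in> ?V - S. fst v = j} = {v \<in> ?V. fst v = j}" using S by auto
          then show ?thesis using fib[OF j] False by (simp add: lm)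
        qed
        moreover have "Poly_Mapping.keys (?m i t) \<subseteq> {1..Suc n}"
          using True by (auto simp: in_keys_iff lm subset_iff)
        moreover have "fst ` (?V - S) \<subseteq> {1..Suc n}" by (auto simp: leaf_set_def)
        ultimately have D: "?D i (?m i t) = qconst (\<iota> (1 / ?P (?m i t))) * ?F i S"
          by (intro mps_deriv_or_id_Y_coeff[OF \<iota>]) (use fin s i in auto)
        \<comment> \<open>The two products of factorials differ only in the factor for i + 1, which
          is c! against (c - t)!.\<close>
        have "?P m = (\<Prod>j\<in>{1..Suc n}. fact (Poly_Mapping.lookup (?m i t) j) *
            (if j = Suc i then fact ?c / fact (?c - t) else 1))"
          by (rule prod.cong) (auto simp: lm)
        also have "\<dots> = ?P (?m i t) * (fact ?c / fact (?c - t))"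
          using i by (simp add: prod.distrib prod.delta del: prod.cl_ivl_Suc)
        finally have P: "fact (?c - t) / fact ?c * (1 / ?P (?m i t)) = 1 / ?P m"
          by (simp del: prod.cl_ivl_Suc)
        show ?thesis
          unfolding t_def[symmetric] g_def D P[symmetric] rat_embedding_mult[OF \<iota>] qconst_mult
          by (simp only: ac_simps)
      qed
      have "qconst (\<iota> (1 / ?P m)) * (\<Sum>S\<in>Pow ?A. qconst (\<phi> (card S)) * qvar i * ?F i S) =
          (\<Sum>S\<in>Pow ?A. g (card S))"
        unfolding sum_distrib_left by (rule sum.cong[OF refl]) (use summand in blast)
      also have "\<dots> = (\<Sum>t\<le>?c. of_nat (?c choose t) * g t)"
        using sum_Pow_card[OF finA] cardA by simp
      also have "\<dots> = (\<Sum>t\<le>?c. qconst (\<phi> t * \<iota> (1 / fact t)) * (qvar i * ?D i (?m i t)))"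
      proof (rule sum.cong[OF refl])
        fix t assume "t \<in> {..?c}"
        then have b: "1 / fact t = of_nat (?c choose t) * (fact (?c - t) / fact ?c :: rat)"
          by (simp add: binomial_fact)
        show "of_nat (?c choose t) * g t =
            qconst (\<phi> t * \<iota> (1 / fact t)) * (qvar i * ?D i (?m i t))"
          unfolding g_def b rat_embedding_mult[OF \<iota>] rat_embedding_of_nat[OF \<iota>]
            qconst_mult qconst_of_nat
          by (simp only: ac_simps)
      qed
      finally show ?thesis .
    qed
    then have "(\<Sum>i\<le>n. qconst (\<iota> (1 / ?P m)) *
        (\<Sum>S\<in>Pow {v \<in> ?V. fst v = Suc i}. qconst (\<phi> (card S)) * qvar i * ?F i S)) =
        (\<Sum>i\<le>n. \<Sum>t\<le>Poly_Mapping.lookup m (Suc i).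
           qconst (\<phi> t * \<iota> (1 / fact t)) * (qvar i * ?D i (?m i t)))"
      by (intro sum.cong) auto
    moreover have "mps_coeff (Y_series \<iota> \<phi> (Suc n)) m =
        qconst (\<iota> (1 / ?P m)) * forest_sum \<phi> (Suc n) ?V fst"
      using True by (simp only: Y_series_def mps_coeff_Abs if_True)
    ultimately show ?thesis
      by (simp only: R forest_sum_Suc[OF fin s] sum_distrib_left[of _ _ "{..n}"])
  qed
qed

text \<open>With no internal vertex there is only the empty forest, of weight 1, so the recurrence
  may start at 0.\<close>

lemma Y_series_0:
  assumes \<iota>: "rat_embedding \<iota>"
  shows "Y_series \<iota> \<phi> 0 = 1"
proof (rule mps_eqI)
  fix k :: monom
  have "increasing_forests 0 {} \<kappa> = {{}}" for \<kappa> :: "nat \<times> nat \<Rightarrow> nat"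
    by (auto simp: increasing_forests_iff inc_forest_def)
  then have "forest_sum \<phi> 0 {} (fst :: nat \<times> nat \<Rightarrow> nat) = 1"
    by (simp add: forest_sum_def forest_weight_def)
  then show "mps_coeff (Y_series \<iota> \<phi> 0) k = mps_coeff 1 k"
    by (simp add: Y_series_def one_mps_def leaf_set_def rat_embedding_1[OF \<iota>] qconst_def)
qed

theorem mainTheorem9:
  fixes \<iota> :: "rat \<Rightarrow> 'r::comm_ring_1" and \<phi> :: "nat \<Rightarrow> 'r"
  assumes "rat_embedding \<iota>"
  shows "Y_series \<iota> \<phi> 1 = fps_at_var (egf \<iota> \<phi>) 1 * mps_const (qvar 0) \<and>
    (\<forall>n\<ge>2. Y_series \<iota> \<phi> n =
       fps_at_var (egf \<iota> \<phi>) 1 * mps_const (qvar 0) * Y_series \<iota> \<phi> (n - 1) +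
       (\<Sum>i=1..n-1. fps_at_var (egf \<iota> \<phi>) (i + 1) * mps_const (qvar i) *
          mps_deriv i (Y_series \<iota> \<phi> (n - 1))))"
proof -
  \<comment> \<open>The term i = 0, in which the largest vertex is a root, is split off from the
    uniform sum.\<close>
  have step: "Y_series \<iota> \<phi> (Suc n) =
       fps_at_var (egf \<iota> \<phi>) 1 * mps_const (qvar 0) * Y_series \<iota> \<phi> n +
       (\<Sum>i=1..n. fps_at_var (egf \<iota> \<phi>) (i + 1) * mps_const (qvar i) *
          mps_deriv i (Y_series \<iota> \<phi> n))" for n
  proof -
    have "{..n} = insert 0 {1..n}" by auto
    then show ?thesis
      unfolding Y_series_Suc[OF assms] by (simp add: mps_deriv_or_id_def)
  qed
  show ?thesis
  proof (intro conjI allI impI)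
    \<comment> \<open>For a single internal vertex the sum over i is empty and the factor for n = 0
      is 1.\<close>
    show "Y_series \<iota> \<phi> 1 = fps_at_var (egf \<iota> \<phi>) 1 * mps_const (qvar 0)"
      using step[of 0] by (simp add: Y_series_0[OF assms])
  next
    fix n :: nat assume "n \<ge> 2"
    then show "Y_series \<iota> \<phi> n =
       fps_at_var (egf \<iota> \<phi>) 1 * mps_const (qvar 0) * Y_series \<iota> \<phi> (n - 1) +
       (\<Sum>i=1..n-1. fps_at_var (egf \<iota> \<phi>) (i + 1) * mps_const (qvar i) *
          mps_deriv i (Y_series \<iota> \<phi> (n - 1)))"
      using step[of "n - 1"] by simp
  qed
qed

end
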